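(* For all $q>0$, $p>1$ and $d\in\mathbb{N}$, and any probability measure $\mu$ on $\mathbb{R}^{d}$ with a $p$-log-concave density function, there exist $c,\widetilde{c}>0$ such that for all $n\in\mathbb{N}$ with $n\geq d+2$, if $(x_{i})_{1}^{n}$ is an i.i.d. sample from $\mu$, $P_{n}=\operatorname{conv}\{x_{i}\}_{1}^{n}$ and $F_{1/n}$ is the floating body of $\mu$ with parameter $1/n$, then with probability at least $1-\widetilde{c}(\log n)^{-q}$ we have $$d_{\mathcal{H}}(P_{n},F_{1/n})\leq c\,\frac{\log\log n}{(\log n)^{1-1/p}}.$$
   Context: A density $f$ on $\mathbb{R}^d$ is $p$-log-concave if it is of the form $f(x)=c_0\exp(-g(x)^{p})$ where $c_0>0$ and $g$ is a nonnegative convex function $\mathbb{R}^d\to[0,\infty]$ (with the convention $e^{-\infty}=0$). Floating body: for $x\in\mathbb{R}^d$ let $\widetilde{f}(x)=\inf_{\mathfrak{H}}\mu(\mathfrak{H})$, where $\mathfrak{H}$ runs through all open half-spaces containing $x$. For $\delta>0$, $F_{\delta}=\{x\in\mathbb{R}^{d}: \widetilde{f}(x)\geq\delta\}$. $d_{\mathcal{H}}$ is the Hausdorff distance with respect to the Euclidean norm: $d_{\mathcal{H}}(K,L)=\max\{\max_{k\in K}d(k,L);\max_{l\in L}d(K,l)\}$. *)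

theory Defs
  imports "HOL-Probability.Probability"
begin

definition convex_extended :: "('a::real_vector \<Rightarrow> ennreal) \<Rightarrow> bool" where
  "convex_extended g \<longleftrightarrow>
     (\<forall>x y. \<forall>u\<ge>0. \<forall>v\<ge>0. u + v = 1 \<longrightarrow>
        g (u *\<^sub>R x + v *\<^sub>R y) \<le> ennreal u * g x + ennreal v * g y)"

definition p_log_concave :: "real \<Rightarrow> ('a::real_vector \<Rightarrow> real) \<Rightarrow> bool" where
  "p_log_concave p f \<longleftrightarrow>
     (\<exists>c0 g. c0 > 0 \<and> convex_extended g \<and>
        (\<forall>x. f x = (if g x = \<infinity> then 0 else c0 * exp (- (enn2real (g x) powr p)))))"

(* The density is only required to be Lebesgue measurable, since a p-log-concave function
   need not be Borel: its values on the frontier of its support can be irregular. This is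
   why the measure is not written as density lborel f. *)
definition has_density :: "'a::euclidean_space measure \<Rightarrow> ('a \<Rightarrow> real) \<Rightarrow> bool" where
  "has_density \<mu> f \<longleftrightarrow>
     f \<in> borel_measurable lebesgue \<and> (\<forall>x. f x \<ge> 0) \<and> sets \<mu> = sets borel \<and>
     (\<forall>A\<in>sets borel. emeasure \<mu> A = (\<integral>\<^sup>+x\<in>A. ennreal (f x) \<partial>lebesgue))"

definition open_halfspaces :: "'a::euclidean_space set set" where
  "open_halfspaces = {{y. a \<bullet> y < b} | a b. a \<noteq> 0}"

definition halfspace_depth :: "'a::euclidean_space measure \<Rightarrow> 'a \<Rightarrow> real" where
  "halfspace_depth \<mu> x = (INF H\<in>{H \<in> open_halfspaces. x \<in> H}. measure \<mu> H)"

definition floating_body :: "'a::euclidean_space measure \<Rightarrow> real \<Rightarrow> 'a set" where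
  "floating_body \<mu> \<delta> = {x. halfspace_depth \<mu> x \<ge> \<delta>}"

(* Meaningful for nonempty bounded sets. A floating body of a probability measure on R^d with
   parameter at most 1/(d+1) is nonempty (centerpoint theorem) and compact. *)
definition hausdorff_distance :: "'a::metric_space set \<Rightarrow> 'a set \<Rightarrow> real" where
  "hausdorff_distance K L = max (SUP k\<in>K. infdist k L) (SUP l\<in>L. infdist l K)"

(* The joint law of an i.i.d. sample (x_i), i < n, from \<mu>. *)
definition iid_sample :: "nat \<Rightarrow> 'a measure \<Rightarrow> (nat \<Rightarrow> 'a) measure" where
  "iid_sample n \<mu> = Pi\<^sub>M {..<n} (\<lambda>_. \<mu>)"

definition random_polytope :: "nat \<Rightarrow> (nat \<Rightarrow> 'a::real_vector) \<Rightarrow> 'a set" where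
  "random_polytope n x = convex hull (x ` {..<n})"

end

theory Submission
  imports Defs "HOL-Real_Asymp.Real_Asymp"
begin

text \<open>
The random polytope and the floating body are both compared with the sets where the density
\<open>f\<close> is at least \<open>exp (- s)\<close>, for \<open>s\<close> close to \<open>ln n\<close>.

Let \<open>N = ln n\<close>, let \<open>d\<close> be the dimension and \<open>W\<close> the set where \<open>f\<close> is at least \<open>N\<^bsup>-K\<^esup> / n\<close>, for a
large constant \<open>K\<close>. Outside \<open>W\<close>, the mass is \<open>O(N\<^bsup>d-K\<^esup> / n)\<close>, because a log-concave density
decays exponentially (\<open>prob_outside_superlevel_le\<close>). Hence the whole sample lies in the closure of
\<open>W\<close> with probability \<open>1 - O(N\<^bsup>d-K\<^esup>)\<close>, and so does its hull because \<open>W\<close> is convex. A point outside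
the closure of \<open>W\<close> is separated from it by a half-space of mass less than \<open>1 / n\<close>, so the
floating body lies in this closure as well (\<open>floating_body_subset\<close>).

Conversely, contract \<open>W\<close> towards a fixed interior point \<open>x0\<close> by a factor \<open>1 - \<tau>\<close>, where
\<open>\<tau>\<close> is of order \<open>ln N / N\<close>. By log-concavity, each point of the contracted set is the centre of a ball
of radius proportional to \<open>\<tau>\<close> on which \<open>f\<close> is at least \<open>N\<^bsup>K\<^esup> / n\<close>
(\<open>contraction_ball_superlevel\<close>). Already half of this radius gives a ball of mass at least \<open>N\<^sup>2 / n\<close>. Every
half-space containing the centre contains such a ball, so the centre is in the floating body
(\<open>mem_floating_body\<close>). A given ball of this mass is missed by the sample with probability at most
\<open>exp (- N\<^sup>2)\<close>, and at most \<open>n = exp N\<close> disjoint ones exist, so with high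
probability the sample comes within a distance of order \<open>\<tau>\<close> of every point of the contracted set
(\<open>ex_separated_net\<close>, \<open>prob_sample_hits\<close>).

Both sets are thus squeezed between \<open>W\<close> and its contraction, up to an error of order \<open>\<tau>\<close>, and
their distance is of order \<open>\<tau>\<close> times the radius of \<open>W\<close> around \<open>x0\<close>. Since \<open>f\<close> is \<open>p\<close>-log-concave,
this radius is \<open>O(N\<^bsup>1/p\<^esup>)\<close> (\<open>superlevel_p_growth\<close>), which gives the rate
\<open>(ln N / N) N\<^bsup>1/p\<^esup>\<close>.
\<close>

section \<open>Log-concave functions and their superlevel sets\<close>

text \<open>
This is convexity of the epigraph of \<open>- ln f\<close>, with \<open>- ln 0 = \<infinity>\<close>.
In this form the usual inequality becomes \<open>superlevel_convex_comb\<close> below, and no power \<open>0\<^sup>0\<close>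
has to be given a meaning.
\<close>

definition log_concave :: "('a::real_vector \<Rightarrow> real) \<Rightarrow> bool" where
  "log_concave f \<longleftrightarrow> convex {(x, s). exp (- s) \<le> f x}"

text \<open>
The level is measured on the scale of \<open>- ln f\<close>, so that the sets increase with \<open>s\<close> and level
\<open>ln n\<close> corresponds to density \<open>1 / n\<close>.
\<close>

definition superlevel :: "('a \<Rightarrow> real) \<Rightarrow> real \<Rightarrow> 'a set" where
  "superlevel f s = {x. exp (- s) \<le> f x}"

lemma superlevel_mono: "s \<le> t \<Longrightarrow> superlevel f s \<subseteq> superlevel f t"
  unfolding superlevel_def by (auto intro: order_trans[rotated])

lemma superlevel_convex_comb:
  assumes "log_concave f" "x \<in> superlevel f s" "y \<in> superlevel f t" "0 \<le> u" "0 \<le> v" "u + v = 1"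
  shows "u *\<^sub>R x + v *\<^sub>R y \<in> superlevel f (u * s + v * t)"
proof -
  have "u *\<^sub>R (x, s) + v *\<^sub>R (y, t) \<in> {(x, s). exp (- s) \<le> f x}"
    using assms unfolding log_concave_def superlevel_def by (intro convexD) auto
  then show ?thesis
    by (simp add: superlevel_def)
qed

lemma convex_superlevel:
  assumes "log_concave f"
  shows "convex (superlevel f s)"
proof (rule convexI)
  fix x y and u v :: real
  assume *: "x \<in> superlevel f s" "y \<in> superlevel f s" "0 \<le> u" "0 \<le> v" "u + v = 1"
  have "u * s + v * s = s"
    using * by (metis distrib_right mult_1)
  then show "u *\<^sub>R x + v *\<^sub>R y \<in> superlevel f s"
    using superlevel_convex_comb[OF assms *] by simp
qed

lemma superlevel_p_log_concave:
  assumes f: "\<And>x. f x = (if g x = \<infinity> then 0 else c0 * exp (- (enn2real (g x) powr p)))" and "c0 > 0"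
  shows "x \<in> superlevel f s \<longleftrightarrow> g x \<noteq> \<infinity> \<and> enn2real (g x) powr p \<le> s + ln c0"
proof (cases "g x = \<infinity>")
  case False
  have "c0 * exp (- (enn2real (g x) powr p)) = exp (ln c0 - enn2real (g x) powr p)"
    using \<open>c0 > 0\<close> by (simp add: exp_diff exp_minus divide_inverse)
  then show ?thesis
    using False by (auto simp: superlevel_def f)
next
  case True
  then show ?thesis
    by (simp add: superlevel_def f not_le)
qed

lemma convex_extended_enn2real:
  assumes "convex_extended g" "g x \<noteq> \<infinity>" "g y \<noteq> \<infinity>" "0 \<le> u" "0 \<le> v" "u + v = 1"
  shows "g (u *\<^sub>R x + v *\<^sub>R y) \<noteq> \<infinity>"
    and "enn2real (g (u *\<^sub>R x + v *\<^sub>R y)) \<le> u * enn2real (g x) + v * enn2real (g y)"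
proof -
  have le: "g (u *\<^sub>R x + v *\<^sub>R y) \<le> ennreal u * g x + ennreal v * g y"
    using assms unfolding convex_extended_def by blast
  have eq: "ennreal u * g x + ennreal v * g y = ennreal (u * enn2real (g x) + v * enn2real (g y))"
    using assms by (cases "g x"; cases "g y") (auto simp: ennreal_mult ennreal_plus)
  show fin: "g (u *\<^sub>R x + v *\<^sub>R y) \<noteq> \<infinity>"
    using le unfolding eq by (auto simp: top_unique)
  show "enn2real (g (u *\<^sub>R x + v *\<^sub>R y)) \<le> u * enn2real (g x) + v * enn2real (g y)"
    using le assms unfolding eq by (intro enn2real_leI) auto
qed

lemma powr_convex_nonneg:
  fixes p :: real
  assumes "p \<ge> 1"
  shows "convex_on {0..} (\<lambda>x. x powr p)"
proof (rule convex_onI)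
  have zero: "(u * b) powr p \<le> u * b powr p" if "0 \<le> u" "u \<le> 1" "0 \<le> b" for u b :: real
  proof -
    have "u powr p \<le> u powr 1"
      using that assms by (intro powr_mono') auto
    then show ?thesis
      using that by (simp add: powr_mult mult_right_mono)
  qed
  fix t x y :: real
  assume *: "0 < t" "t < 1" "x \<in> {0..}" "y \<in> {0..}"
  consider "x = 0" | "y = 0" | "x > 0" "y > 0"
    using * by fastforce
  then show "((1 - t) *\<^sub>R x + t *\<^sub>R y) powr p \<le> (1 - t) * x powr p + t * y powr p"
  proof cases
    case 3
    then show ?thesis
      using convex_onD[OF powr_convex[OF assms], of t x y] * by simp
  qed (use * zero in auto)
qed simp

text \<open>
For \<open>p \<ge> 1\<close> the function \<open>g\<^sup>p\<close> is convex, being the composition of the convex function \<open>g\<close>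
with an increasing convex function.
\<close>

lemma p_log_concave_imp_log_concave:
  fixes f :: "'a::real_vector \<Rightarrow> real"
  assumes "p_log_concave p f" "p \<ge> 1"
  shows "log_concave f"
proof -
  obtain c0 g where "c0 > 0" and g: "convex_extended g"
    and f: "\<And>x. f x = (if g x = \<infinity> then 0 else c0 * exp (- (enn2real (g x) powr p)))"
    using assms unfolding p_log_concave_def by auto
  note sup = superlevel_p_log_concave[where f=f, OF f \<open>c0 > 0\<close>]
  have "u *\<^sub>R x + v *\<^sub>R y \<in> superlevel f (u * s + v * t)"
    if *: "x \<in> superlevel f s" "y \<in> superlevel f t" "0 \<le> u" "0 \<le> v" "u + v = 1" for x y s t u v
  proof -
    let ?a = "enn2real (g x)" and ?b = "enn2real (g y)" and ?z = "u *\<^sub>R x + v *\<^sub>R y"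
    have fin: "g x \<noteq> \<infinity>" "g y \<noteq> \<infinity>" and le: "?a powr p \<le> s + ln c0" "?b powr p \<le> t + ln c0"
      using * sup by auto
    note z = convex_extended_enn2real[OF g fin *(3-5)]
    have "enn2real (g ?z) powr p \<le> (u * ?a + v * ?b) powr p"
      using z(2) \<open>p \<ge> 1\<close> by (intro powr_mono2) auto
    also have "\<dots> \<le> u * ?a powr p + v * ?b powr p"
      using powr_convex_nonneg[OF \<open>p \<ge> 1\<close>] * unfolding convex_on_def by auto
    also have "\<dots> \<le> u * (s + ln c0) + v * (t + ln c0)"
      using le * by (intro add_mono mult_left_mono) auto
    also have "\<dots> = (u * s + v * t) + (u + v) * ln c0"
      by (simp add: algebra_simps)
    finally show ?thesis
      using z(1) *(5) sup by simp
  qed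
  then show ?thesis
    unfolding log_concave_def superlevel_def by (auto simp: convex_def)
qed

text \<open>
On the segment from \<open>x0\<close> to \<open>x\<close>, the function \<open>g\<close> has already risen by 1 when it leaves the ball of
radius \<open>R\<close>; by convexity it keeps at least this slope.
\<close>

lemma sublevel_linear_growth:
  fixes g :: "'a::real_normed_vector \<Rightarrow> ennreal"
  assumes g: "convex_extended g" and x0: "g x0 \<le> ennreal a" and "a \<ge> 0" and "R > 0"
    and ball: "\<And>y. g y \<le> ennreal (a + 1) \<Longrightarrow> norm (y - x0) < R"
    and x: "g x \<noteq> \<infinity>"
  shows "norm (x - x0) \<le> R * (1 + enn2real (g x))"
proof (cases "norm (x - x0) \<le> R")
  case True
  then show ?thesis
    using \<open>R > 0\<close> by (simp add: distrib_left) (smt (verit) enn2real_nonneg mult_nonneg_nonneg)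
next
  case False
  define t where "t = R / norm (x - x0)"
  have t: "0 < t" "t \<le> 1"
    using False \<open>R > 0\<close> by (auto simp: t_def zero_less_divide_iff divide_le_eq_1 simp del: zero_less_norm_iff)
  \<comment> \<open>the point at which the segment from \<open>x0\<close> to \<open>x\<close> crosses the sphere of radius \<open>R\<close>\<close>
  let ?y = "t *\<^sub>R x + (1 - t) *\<^sub>R x0"
  have "?y - x0 = t *\<^sub>R (x - x0)"
    by (simp add: algebra_simps)
  then have "norm (?y - x0) = R"
    using False \<open>R > 0\<close> by (auto simp: t_def)
  then have far: "\<not> g ?y \<le> ennreal (a + 1)"
    using ball by force
  have fin: "g x0 \<noteq> \<infinity>"
    using x0 by (auto simp: top_unique)
  note y = convex_extended_enn2real[OF g x fin, of t "1 - t"]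
  have "a + 1 < enn2real (g ?y)"
    using far y(1) t by (cases "g ?y") (auto simp: ennreal_le_iff2)
  also have "\<dots> \<le> t * enn2real (g x) + (1 - t) * enn2real (g x0)"
    using y(2) t by auto
  also have "\<dots> \<le> t * enn2real (g x) + 1 * a"
    using t x0 \<open>a \<ge> 0\<close> by (intro add_mono mult_mono order_refl) (auto simp: enn2real_leI)
  finally have "1 < R * enn2real (g x) / norm (x - x0)"
    by (simp add: t_def)
  moreover have "norm (x - x0) > 0"
    using False \<open>R > 0\<close> by auto
  ultimately have "norm (x - x0) < R * enn2real (g x)"
    by (simp add: field_simps)
  then show ?thesis
    using \<open>R > 0\<close> by (simp add: distrib_left)
qed

text \<open>
Moving \<open>x\<close> towards the centre \<open>x0\<close> by a proportion \<open>\<tau>\<close> lowers the level by a proportion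
of its distance to \<open>s0\<close>, and at the same time gains a ball of radius proportional to \<open>\<tau>\<close>. This
is how a small loss in level buys room around every point.
\<close>

lemma contraction_ball_superlevel:
  fixes f :: "'a::real_normed_vector \<Rightarrow> real"
  assumes f: "log_concave f" and ball: "ball x0 r \<subseteq> superlevel f s0" and x: "x \<in> superlevel f s"
    and \<tau>: "0 \<le> \<tau>" "\<tau> \<le> 1"
  shows "ball ((1 - \<tau>) *\<^sub>R x + \<tau> *\<^sub>R x0) (\<tau> * r) \<subseteq> superlevel f ((1 - \<tau>) * s + \<tau> * s0)"
proof
  fix y assume y: "y \<in> ball ((1 - \<tau>) *\<^sub>R x + \<tau> *\<^sub>R x0) (\<tau> * r)"
  then have "\<tau> * r > 0"
    by (metis ball_eq_empty empty_iff not_le)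
  then have "\<tau> > 0"
    using \<tau> by (cases "\<tau> = 0") auto
  \<comment> \<open>the solution of \<open>(1 - \<tau>) x + \<tau> v = y\<close>\<close>
  let ?v = "(1 / \<tau>) *\<^sub>R (y - (1 - \<tau>) *\<^sub>R x)"
  have "dist x0 ?v = norm ((1 / \<tau>) *\<^sub>R (((1 - \<tau>) *\<^sub>R x + \<tau> *\<^sub>R x0) - y))"
    using \<open>\<tau> > 0\<close> by (simp add: dist_norm algebra_simps)
  also have "\<dots> = dist ((1 - \<tau>) *\<^sub>R x + \<tau> *\<^sub>R x0) y / \<tau>"
    using \<open>\<tau> > 0\<close> unfolding dist_norm norm_scaleR by simp
  also have "\<dots> < r"
    using y \<open>\<tau> > 0\<close> by (simp add: divide_less_eq mult.commute)
  finally have "?v \<in> superlevel f s0"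
    using ball by auto
  from superlevel_convex_comb[OF f x this, of "1 - \<tau>" \<tau>] 
  show "y \<in> superlevel f ((1 - \<tau>) * s + \<tau> * s0)"
    using \<tau> \<open>\<tau> > 0\<close> by simp
qed

section \<open>Probability measures with a log-concave density\<close>

locale log_concave_measure = prob_space \<mu> for \<mu> :: "'a::euclidean_space measure" +
  fixes f :: "'a \<Rightarrow> real"
  assumes density: "has_density \<mu> f"
    and log_concave: "log_concave f"
begin

lemma density_measurable [measurable]: "f \<in> borel_measurable lebesgue"
  and density_nonneg: "0 \<le> f x"
  and sets_eq [measurable_cong]: "sets \<mu> = sets borel"
  and emeasure_eq: "A \<in> sets borel \<Longrightarrow> emeasure \<mu> A = (\<integral>\<^sup>+x\<in>A. ennreal (f x) \<partial>lebesgue)"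
  using density unfolding has_density_def by auto

lemma space_eq: "space \<mu> = UNIV"
  using sets_eq_imp_space_eq[OF sets_eq] by simp

text \<open>
The balls of radius \<open>\<rho>\<close> around the points are disjoint, and their total mass is at most 1.
\<close>

lemma card_separated_le:
  fixes m \<rho> :: real
  assumes "finite Z"
    and sep: "\<And>y z. y \<in> Z \<Longrightarrow> z \<in> Z \<Longrightarrow> y \<noteq> z \<Longrightarrow> 2 * \<rho> \<le> dist y z"
    and mass: "\<And>z. z \<in> Z \<Longrightarrow> m \<le> prob (ball z \<rho>)"
  shows "card Z * m \<le> 1"
proof -
  have "disjoint_family_on (\<lambda>z. ball z \<rho>) Z"
    unfolding disjoint_family_on_def
  proof (intro ballI impI)
    fix y z assume "y \<in> Z" "z \<in> Z" "y \<noteq> z"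
    then show "ball y \<rho> \<inter> ball z \<rho> = {}"
      using sep[of y z] by (intro disjoint_ballI) simp
  qed
  then have "prob (\<Union>z\<in>Z. ball z \<rho>) = (\<Sum>z\<in>Z. prob (ball z \<rho>))"
    using assms(1) by (intro finite_measure_finite_Union) auto
  moreover have "(\<Sum>z\<in>Z. prob (ball z \<rho>)) \<ge> card Z * m"
    using mass by (intro sum_bounded_below) auto
  ultimately show ?thesis
    using prob_le_1[of "\<Union>z\<in>Z. ball z \<rho>"] by simp
qed

lemma prob_ball_ge:
  assumes "ball z \<rho> \<subseteq> superlevel f s" "\<rho> \<ge> 0"
  shows "exp (- s) * (unit_ball_vol DIM('a) * \<rho> ^ DIM('a)) \<le> prob (ball z \<rho>)"
proof -
  have "ennreal (exp (- s) * (unit_ball_vol DIM('a) * \<rho> ^ DIM('a)))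
      = ennreal (exp (- s)) * emeasure lborel (ball z \<rho>)"
    using assms by (simp add: emeasure_ball ennreal_mult)
  also have "\<dots> = (\<integral>\<^sup>+x. ennreal (exp (- s)) * indicator (ball z \<rho>) x \<partial>lebesgue)"
    by (simp add: nn_integral_cmult_indicator)
  also have "\<dots> \<le> (\<integral>\<^sup>+x\<in>ball z \<rho>. ennreal (f x) \<partial>lebesgue)"
    using assms(1) by (intro nn_integral_mono) (auto simp: indicator_def superlevel_def intro!: ennreal_leI)
  also have "\<dots> = ennreal (prob (ball z \<rho>))"
    by (simp add: emeasure_eq flip: emeasure_eq_measure)
  finally show ?thesis
    by (simp add: ennreal_le_iff)
qed

text \<open>
A convex set without interior points is negligible. If this happened for all superlevel sets, then
\<open>f\<close> would vanish almost everywhere.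
\<close>

lemma ex_ball_superlevel: "\<exists>x0 r s. r > 0 \<and> ball x0 r \<subseteq> superlevel f s"
proof (rule ccontr)
  assume no_ball: "\<not> ?thesis"
  have null: "superlevel f s \<in> null_sets lebesgue" for s
  proof -
    have "interior (superlevel f s) = {}"
      using no_ball by (auto simp: mem_interior)
    then show ?thesis
      using negligible_convex_interior convex_superlevel[OF log_concave]
      by (auto simp flip: negligible_iff_null_sets)
  qed
  have "(\<Union>k::nat. superlevel f (real k)) \<in> null_sets lebesgue"
    using null by (intro null_sets_UN) auto
  moreover have "{x \<in> space lebesgue. f x \<noteq> 0} \<subseteq> (\<Union>k::nat. superlevel f (real k))"
  proof clarify
    fix x assume "f x \<noteq> 0"
    then have "f x > 0"
      using density_nonneg[of x] by simp
    obtain k :: nat where "- ln (f x) \<le> real k"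
      using real_arch_simple by blast
    then have "exp (- real k) \<le> f x"
      using \<open>f x > 0\<close> by (metis exp_le_cancel_iff exp_ln minus_le_iff)
    then show "x \<in> (\<Union>k::nat. superlevel f (real k))"
      by (auto simp: superlevel_def)
  qed
  ultimately have "AE x in lebesgue. f x = 0"
    by (intro AE_I') auto
  then have "(\<integral>\<^sup>+x. ennreal (f x) \<partial>lebesgue) = 0"
    by (subst nn_integral_0_iff_AE) auto
  moreover have "(\<integral>\<^sup>+x. ennreal (f x) \<partial>lebesgue) = 1"
    using emeasure_eq[of UNIV] emeasure_space_1 by (simp add: space_eq)
  ultimately show False by simp
qed

text \<open>
A far away point of the superlevel set, together with a ball inside the set, spans a long cone. The
half of this cone nearest to the ball contains many disjoint balls of a fixed radius, each of
a mass bounded below, and the packing bound limits their number.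
\<close>

lemma bounded_superlevel: "bounded (superlevel f s)"
proof -
  obtain x0 r s0 where "r > 0" and ball: "ball x0 r \<subseteq> superlevel f s0"
    using ex_ball_superlevel by blast
  define t where "t = max s s0"
  define m where "m = exp (- t) * (unit_ball_vol DIM('a) * (r / 2) ^ DIM('a))"
  have "m > 0"
    using \<open>r > 0\<close> by (simp add: m_def)
  have ball: "ball x0 r \<subseteq> superlevel f t"
    using ball superlevel_mono[of s0 t f] by (auto simp: t_def)
  obtain k :: nat where k: "k * m > 1"
    using reals_Archimedean3[OF \<open>m > 0\<close>] by blast
  have "norm (x - x0) \<le> 2 * k * r" if "x \<in> superlevel f s" for x
  proof (rule ccontr)
    assume far: "\<not> norm (x - x0) \<le> 2 * k * r"
    then have pos: "norm (x - x0) > 0"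
      using \<open>r > 0\<close> by (smt (verit) mult_nonneg_nonneg of_nat_0_le_iff)
    have x: "x \<in> superlevel f t"
      using that superlevel_mono[of s t f] by (auto simp: t_def)
    \<comment> \<open>\<open>z j\<close> lies on the segment from \<open>x0\<close> to \<open>x\<close>, at distance \<open>j r\<close> from \<open>x0\<close>\<close>
    define z where "z j = (1 - (1 - j * r / norm (x - x0))) *\<^sub>R x + (1 - j * r / norm (x - x0)) *\<^sub>R x0" for j :: nat
    have dist: "dist (z i) (z j) = \<bar>real i - real j\<bar> * r" for i j
    proof -
      have "z i - z j = ((real i - real j) * r / norm (x - x0)) *\<^sub>R (x - x0)"
        by (simp add: z_def algebra_simps diff_divide_distrib)
      then show ?thesis
        using pos \<open>r > 0\<close> by (simp add: dist_norm abs_mult)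
    qed
    have sep: "r \<le> dist (z i) (z j)" if "i \<noteq> j" for i j
    proof -
      have "1 \<le> \<bar>real i - real j\<bar>"
        using that by linarith
      then show ?thesis
        using \<open>r > 0\<close> by (simp add: dist)
    qed
    have "inj z"
      using sep \<open>r > 0\<close> by (intro injI) fastforce
    have "m \<le> prob (ball (z j) (r / 2))" if "j < k" for j
    proof -
      let ?\<tau> = "1 - j * r / norm (x - x0)"
      have "2 * (real j * r) \<le> 2 * (k * r)"
        using that \<open>r > 0\<close> by simp
      also have "\<dots> \<le> norm (x - x0)"
        using far by simp
      finally have "j * r / norm (x - x0) \<le> 1 / 2"
        using pos by (simp add: divide_le_eq)
      then have \<tau>: "1 / 2 \<le> ?\<tau>" "?\<tau> \<le> 1"
        using \<open>r > 0\<close> by auto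
      have "1 / 2 * r \<le> ?\<tau> * r"
        using \<tau> \<open>r > 0\<close> by (intro mult_right_mono) auto
      then have "ball (z j) (r / 2) \<subseteq> ball (z j) (?\<tau> * r)"
        by (intro subset_ball) simp
      also have "\<dots> \<subseteq> superlevel f ((1 - ?\<tau>) * t + ?\<tau> * t)"
        using contraction_ball_superlevel[OF log_concave ball x, of ?\<tau>] \<tau> by (simp add: z_def)
      also have "(1 - ?\<tau>) * t + ?\<tau> * t = t"
        by (simp add: left_diff_distrib)
      finally show ?thesis
        unfolding m_def using \<open>r > 0\<close> by (intro prob_ball_ge) auto
    qed
    then have "card (z ` {..<k}) * m \<le> 1"
      by (intro card_separated_le[where \<rho> = "r / 2"]) (auto, metis sep)
    moreover have "card (z ` {..<k}) = k"
      using \<open>inj z\<close> by (simp add: card_image inj_on_subset)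
    ultimately show False
      using k by simp
  qed
  then have "superlevel f s \<subseteq> cball x0 (2 * k * r)"
    by (auto simp: dist_norm norm_minus_commute)
  then show ?thesis
    using bounded_subset bounded_cball by blast
qed

text \<open>
Sublevel sets of \<open>g\<close> are superlevel sets of \<open>f\<close>, hence bounded, so \<open>g\<close> grows at least linearly. The
bound \<open>g\<^sup>p \<le> s + const\<close> then confines \<open>x\<close> to a ball of radius of order \<open>s\<^bsup>1/p\<^esup>\<close>. This
is where the exponent \<open>p\<close> enters the rate: the relative error of the comparison is multiplied by this
radius.
\<close>

lemma superlevel_p_growth:
  assumes f: "p_log_concave p f" and "p > 0"
  shows "\<exists>R>0. \<forall>s\<ge>1. \<forall>x\<in>superlevel f s. norm (x - x0) \<le> R * s powr (1 / p)"
proof -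
  obtain c0 g where "c0 > 0" and g: "convex_extended g"
    and f: "\<And>x. f x = (if g x = \<infinity> then 0 else c0 * exp (- (enn2real (g x) powr p)))"
    using f unfolding p_log_concave_def by auto
  note sup = superlevel_p_log_concave[where f=f, OF f \<open>c0 > 0\<close>]
  obtain x1 r s1 where "r > 0" "ball x1 r \<subseteq> superlevel f s1"
    using ex_ball_superlevel by blast
  then have "x1 \<in> superlevel f s1" by auto
  then have fin: "g x1 \<noteq> \<infinity>"
    using sup by auto
  define a where "a = enn2real (g x1)"
  have "g x1 \<le> ennreal a" "a \<ge> 0"
    using fin by (auto simp: a_def less_top)
  have sub: "{y. g y \<le> ennreal (a + 1)} \<subseteq> superlevel f ((a + 1) powr p - ln c0)"
  proof clarify
    fix y assume y: "g y \<le> ennreal (a + 1)"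
    then have "enn2real (g y) \<le> a + 1"
      using \<open>a \<ge> 0\<close> by (simp add: enn2real_leI)
    then have "enn2real (g y) powr p \<le> (a + 1) powr p"
      using \<open>p > 0\<close> by (intro powr_mono2) auto
    then show "y \<in> superlevel f ((a + 1) powr p - ln c0)"
      using y by (auto simp: sup top_unique)
  qed
  then have "bounded {y. g y \<le> ennreal (a + 1)}"
    using bounded_superlevel bounded_subset by blast
  then obtain R0 where R0: "\<And>y. g y \<le> ennreal (a + 1) \<Longrightarrow> norm (y - x1) \<le> R0"
    unfolding bounded_any_center[where a=x1] by (auto simp: dist_norm norm_minus_commute)
  define R where "R = \<bar>R0\<bar> + 1"
  have R: "norm (y - x1) < R" if "g y \<le> ennreal (a + 1)" for y
    using R0[OF that] by (auto simp: R_def)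
  have "R > 0"
    by (simp add: R_def)
  define C where "C = norm (x1 - x0) + R * (1 + (1 + \<bar>ln c0\<bar>) powr (1 / p))"
  have "C > 0"
    using \<open>R > 0\<close> by (auto simp: C_def intro!: add_nonneg_pos mult_pos_pos)
  moreover have "norm (x - x0) \<le> C * s powr (1 / p)" if "s \<ge> 1" "x \<in> superlevel f s" for s x
  proof -
    have x: "g x \<noteq> \<infinity>" "enn2real (g x) powr p \<le> s + ln c0"
      using that sup by auto
    have one: "1 \<le> s powr (1 / p)"
      using that \<open>p > 0\<close> by (intro ge_one_powr_ge_zero) auto
    have "s + ln c0 \<le> (1 + \<bar>ln c0\<bar>) * s"
      using that(1) mult_left_mono[of 1 s "\<bar>ln c0\<bar>"] by (simp add: algebra_simps)
    then have "enn2real (g x) powr p \<le> (1 + \<bar>ln c0\<bar>) * s"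
      using x(2) by linarith
    then have "(enn2real (g x) powr p) powr (1 / p) \<le> ((1 + \<bar>ln c0\<bar>) * s) powr (1 / p)"
      using \<open>p > 0\<close> by (intro powr_mono2) auto
    then have gx: "enn2real (g x) \<le> (1 + \<bar>ln c0\<bar>) powr (1 / p) * s powr (1 / p)"
      using \<open>p > 0\<close> that by (simp add: powr_powr powr_mult)
    have "norm (x - x1) \<le> R * (1 + enn2real (g x))"
      using sublevel_linear_growth[OF g \<open>g x1 \<le> ennreal a\<close> \<open>a \<ge> 0\<close> \<open>R > 0\<close> R x(1)] by simp
    also have "\<dots> \<le> R * (s powr (1 / p) + (1 + \<bar>ln c0\<bar>) powr (1 / p) * s powr (1 / p))"
      using gx one \<open>R > 0\<close> by (intro mult_left_mono) auto
    finally have "norm (x - x1) \<le> R * (1 + (1 + \<bar>ln c0\<bar>) powr (1 / p)) * s powr (1 / p)"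
      by (simp add: algebra_simps)
    moreover have "norm (x1 - x0) \<le> norm (x1 - x0) * s powr (1 / p)"
      using one mult_left_mono[OF one, of "norm (x1 - x0)"] by simp
    moreover have "norm (x - x0) \<le> norm (x - x1) + norm (x1 - x0)"
      by (metis diff_add_cancel add_diff_eq norm_triangle_ineq)
    ultimately show ?thesis
      unfolding C_def distrib_right by linarith
  qed
  ultimately show ?thesis by blast
qed

end

section \<open>The mass outside a superlevel set\<close>

text \<open>
Off the origin, the integrand is a multiple of the sum of an exponential density and its reflection.
\<close>

lemma nn_integral_exp_abs_le:
  assumes "a > 0"
  shows "(\<integral>\<^sup>+x. ennreal (exp (- a * \<bar>x\<bar>)) \<partial>lborel) \<le> ennreal (2 / a)"
proof -
  interpret E: prob_space "density lborel (exponential_density a)"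
    using prob_space_exponential_density[OF assms] .
  have one: "(\<integral>\<^sup>+x. ennreal (exponential_density a x) \<partial>lborel) = 1"
    using E.emeasure_space_1 by (simp add: emeasure_density)
  have "(\<integral>\<^sup>+x. ennreal (exponential_density a (- x)) \<partial>lborel) = (\<integral>\<^sup>+x. ennreal (exponential_density a x) \<partial>lborel)"
    using nn_integral_real_affine[of "\<lambda>x. ennreal (exponential_density a x)" "-1" 0] by simp
  note two = this[unfolded one]
  have "(\<integral>\<^sup>+x. ennreal (exp (- a * \<bar>x\<bar>)) \<partial>lborel)
      \<le> (\<integral>\<^sup>+x. ennreal (1 / a) * (ennreal (exponential_density a x) + ennreal (exponential_density a (- x))) \<partial>lborel)"
  proof (rule nn_integral_mono)
    fix x :: real
    have "exp (- a * \<bar>x\<bar>) \<le> 1 / a * (exponential_density a x + exponential_density a (- x))"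
      using assms by (cases "x < 0"; cases "x = 0") (auto simp: exponential_density_def mult.commute)
    also have "ennreal \<dots> = ennreal (1 / a) * (ennreal (exponential_density a x) + ennreal (exponential_density a (- x)))"
      using assms by (subst ennreal_mult) (auto simp: exponential_density_nonneg)
    finally show "ennreal (exp (- a * \<bar>x\<bar>)) \<le> \<dots>"
      by (simp add: ennreal_leI)
  qed
  also have "\<dots> = ennreal (1 / a) * 2"
    by (simp add: nn_integral_cmult nn_integral_add one two)
  also have "\<dots> = ennreal (2 / a)"
    using assms by (metis divide_inverse ennreal_mult'' ennreal_numeral mult.commute mult_1 zero_le_numeral)
  finally show ?thesis .
qed

text \<open>
Bounding the Euclidean norm below by the average of the absolute coordinates turns the integral into
a product of integrals over the line. Only the polynomial dependence on \<open>1 / a\<close> will matter.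
\<close>

lemma nn_integral_exp_norm_le:
  fixes x0 :: "'a::euclidean_space"
  assumes "a > 0"
  shows "(\<integral>\<^sup>+x. ennreal (exp (- a * norm (x - x0))) \<partial>lborel) \<le> ennreal ((2 * DIM('a) / a) ^ DIM('a))"
proof -
  let ?d = "real DIM('a)"
  have d: "?d > 0" by simp
  have "(\<integral>\<^sup>+x. ennreal (exp (- a * norm (x - x0))) \<partial>lborel) 
      = (\<integral>\<^sup>+x. ennreal (exp (- a * norm x)) \<partial>distr lborel borel ((+) (- x0)))"
    by (subst nn_integral_distr) auto
  also have "\<dots> = (\<integral>\<^sup>+x. ennreal (exp (- a * norm x)) \<partial>(lborel :: 'a measure))"
    by (simp only: lborel_distr_plus)
  also have "\<dots> \<le> (\<integral>\<^sup>+x. (\<Prod>b\<in>Basis. ennreal (exp (- (a / ?d) * \<bar>x \<bullet> b\<bar>))) \<partial>(lborel :: 'a measure))"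
  proof (rule nn_integral_mono)
    fix x :: 'a
    have "(\<Sum>b\<in>Basis. \<bar>x \<bullet> b\<bar>) \<le> ?d * norm x"
      using sum_bounded_above[of Basis "\<lambda>b. \<bar>x \<bullet> b\<bar>" "norm x"] by (simp add: Basis_le_norm)
    then have "(a / ?d) * (\<Sum>b\<in>Basis. \<bar>x \<bullet> b\<bar>) \<le> (a / ?d) * (?d * norm x)"
      using assms d by (intro mult_left_mono) auto
    then have "exp (- a * norm x) \<le> (\<Prod>b\<in>Basis. exp (- (a / ?d) * \<bar>x \<bullet> b\<bar>))"
      using d by (simp add: exp_sum[symmetric] sum_negf sum_distrib_left)
    then show "ennreal (exp (- a * norm x)) \<le> (\<Prod>b\<in>Basis. ennreal (exp (- (a / ?d) * \<bar>x \<bullet> b\<bar>)))"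
      by (simp add: prod_ennreal ennreal_leI)
  qed
  also have "\<dots> = (\<integral>\<^sup>+x. ennreal (exp (- (a / ?d) * \<bar>x\<bar>)) \<partial>lborel) ^ DIM('a)"
    by (subst nn_integral_lborel_prod) auto
  also have "\<dots> \<le> ennreal (2 / (a / ?d)) ^ DIM('a)"
    using assms d by (intro power_mono nn_integral_exp_abs_le) auto
  also have "\<dots> = ennreal ((2 * ?d / a) ^ DIM('a))"
    using assms by (simp add: ennreal_power)
  finally show ?thesis by simp
qed

context log_concave_measure
begin

text \<open>
Write \<open>f = exp (- t)\<close> with \<open>t > s\<close> outside the superlevel set. Splitting \<open>t = (1 - 1/s) t + t/s\<close>,
the first part contributes at most \<open>exp (1 - s)\<close>, while the second still grows linearly in
\<open>norm (x - x0)\<close> and keeps the integral finite, of polynomial size in \<open>s\<close>.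
\<close>

lemma prob_outside_superlevel_le:
  fixes s R :: real
  assumes growth: "\<And>t x. t \<ge> 1 \<Longrightarrow> x \<in> superlevel f t \<Longrightarrow> norm (x - x0) \<le> R * t"
    and "R > 0" "s \<ge> 1"
  shows "prob (- closure (superlevel f s)) \<le> exp (1 - s) * (2 * DIM('a) * R * s) ^ DIM('a)"
proof -
  let ?a = "1 / (R * s)"
  have "?a > 0"
    using assms by simp
  have bound: "f x \<le> exp (1 - s) * exp (- ?a * norm (x - x0))" if "x \<notin> superlevel f s" for x
  proof (cases "f x = 0")
    case False
    then have "f x > 0"
      using density_nonneg[of x] by simp
    define t where "t = - ln (f x)"
    have fx: "f x = exp (- t)"
      using \<open>f x > 0\<close> by (simp add: t_def)
    then have "t > s"
      using that by (simp add: superlevel_def)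
    have "norm (x - x0) \<le> R * t"
      using \<open>t > s\<close> assms fx by (intro growth) (auto simp: superlevel_def)
    then have "?a * norm (x - x0) \<le> t / s"
      using assms by (simp add: field_simps)
    moreover have "t / s \<le> 1 - s + t"
    proof -
      have "(s - 1) * (t - s) \<ge> 0"
        using \<open>t > s\<close> \<open>s \<ge> 1\<close> by (intro mult_nonneg_nonneg) auto
      then show ?thesis
        using \<open>s \<ge> 1\<close> by (simp add: field_simps)
    qed
    ultimately have "exp (- t) \<le> exp ((1 - s) + - ?a * norm (x - x0))"
      by simp
    then show ?thesis
      unfolding fx exp_add .
  qed simp
  have "ennreal (prob (- closure (superlevel f s)))
      = (\<integral>\<^sup>+x\<in>- closure (superlevel f s). ennreal (f x) \<partial>lebesgue)"
    by (simp add: emeasure_eq borel_closed borel_comp flip: emeasure_eq_measure)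
  also have "\<dots> \<le> (\<integral>\<^sup>+x. ennreal (exp (1 - s)) * ennreal (exp (- ?a * norm (x - x0))) \<partial>lebesgue)"
  proof (rule nn_integral_mono)
    fix x
    show "ennreal (f x) * indicator (- closure (superlevel f s)) x 
        \<le> ennreal (exp (1 - s)) * ennreal (exp (- ?a * norm (x - x0)))"
      using bound[of x] closure_subset[of "superlevel f s"]
      by (auto simp: indicator_def ennreal_mult[symmetric] intro!: ennreal_leI)
  qed
  also have "\<dots> = ennreal (exp (1 - s)) * (\<integral>\<^sup>+x. ennreal (exp (- ?a * norm (x - x0))) \<partial>lborel)"
    by (simp add: nn_integral_completion nn_integral_cmult)
  also have "\<dots> \<le> ennreal (exp (1 - s)) * ennreal ((2 * DIM('a) / ?a) ^ DIM('a))"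
    by (intro mult_left_mono nn_integral_exp_norm_le) (use \<open>?a > 0\<close> in auto)
  also have "\<dots> = ennreal (exp (1 - s) * (2 * DIM('a) * R * s) ^ DIM('a))"
    using assms by (simp add: ennreal_mult[symmetric] mult.assoc)
  finally show ?thesis
    using assms by (subst (asm) ennreal_le_iff) auto
qed

end

section \<open>Half-spaces and the floating body\<close>

lemma halfspace_containing_exists:
  fixes z :: "'a::euclidean_space"
  shows "{H \<in> open_halfspaces. z \<in> H} \<noteq> {}"
proof -
  obtain a :: 'a where "a \<in> Basis"
    using nonempty_Basis by blast
  then have "{y. a \<bullet> y < a \<bullet> z + 1} \<in> open_halfspaces"
    unfolding open_halfspaces_def using nonzero_Basis by blast
  then show ?thesis by force
qed

text \<open>
The centre \<open>c\<close> is \<open>z\<close> shifted into the half-space by \<open>\<rho>\<close>, orthogonally to the boundary.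
\<close>

lemma halfspace_contains_ball:
  fixes z :: "'a::euclidean_space"
  assumes "H \<in> open_halfspaces" "z \<in> H" "\<rho> \<ge> 0"
  shows "\<exists>c. ball c \<rho> \<subseteq> H \<and> ball c \<rho> \<subseteq> ball z (2 * \<rho>)"
proof -
  obtain a b where H: "H = {y. a \<bullet> y < b}" and "a \<noteq> 0"
    using assms unfolding open_halfspaces_def by blast
  define c where "c = z - (\<rho> / norm a) *\<^sub>R a"
  have "a \<bullet> y < b" if "y \<in> ball c \<rho>" for y
  proof -
    have "a \<bullet> y = a \<bullet> c + a \<bullet> (y - c)"
      by (simp add: inner_diff_right)
    also have "a \<bullet> c = a \<bullet> z - \<rho> * norm a"
      using \<open>a \<noteq> 0\<close> by (simp add: c_def inner_diff_right dot_square_norm power2_eq_square)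
    also have "a \<bullet> (y - c) \<le> norm a * norm (y - c)"
      by (rule norm_cauchy_schwarz)
    also have "norm a * norm (y - c) \<le> norm a * \<rho>"
      using that by (intro mult_left_mono) (auto simp: dist_norm norm_minus_commute)
    finally show ?thesis
      using assms(2) by (simp add: H algebra_simps)
  qed
  moreover have "ball c \<rho> \<subseteq> ball z (2 * \<rho>)"
  proof -
    have "dist z c = \<rho>"
      using \<open>a \<noteq> 0\<close> \<open>\<rho> \<ge> 0\<close> by (simp add: c_def dist_norm)
    show ?thesis
    proof
      fix y assume "y \<in> ball c \<rho>"
      then show "y \<in> ball z (2 * \<rho>)"
        using \<open>dist z c = \<rho>\<close> dist_triangle[of z y c] by simp
    qed
  qed
  ultimately show ?thesis
    unfolding H by blast
qed

context log_concave_measure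
begin

text \<open>
A half-space containing \<open>z\<close> contains a ball of radius \<open>\<rho>\<close> inside the given ball, and hence
has at least the mass of that smaller ball.
\<close>

lemma mem_floating_body:
  assumes "ball z (2 * \<rho>) \<subseteq> superlevel f s" "\<rho> \<ge> 0"
    and "\<delta> \<le> exp (- s) * (unit_ball_vol DIM('a) * \<rho> ^ DIM('a))"
  shows "z \<in> floating_body \<mu> \<delta>"
proof -
  have "\<delta> \<le> prob H" if H: "H \<in> open_halfspaces" "z \<in> H" for H
  proof -
    obtain c where c: "ball c \<rho> \<subseteq> H" "ball c \<rho> \<subseteq> superlevel f s"
      using halfspace_contains_ball[OF H assms(2)] assms(1) by blast
    have "open H"
      using H(1) unfolding open_halfspaces_def by (auto intro: open_halfspace_lt)
    have "\<delta> \<le> prob (ball c \<rho>)"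
      using prob_ball_ge[OF c(2) assms(2)] assms(3) by linarith
    also have "\<dots> \<le> prob H"
      using c(1) \<open>open H\<close> by (intro finite_measure_mono) (auto simp: sets_eq)
    finally show ?thesis .
  qed
  then show ?thesis
    unfolding floating_body_def halfspace_depth_def
    using halfspace_containing_exists by (auto intro!: cINF_greatest)
qed

text \<open>
A point outside a closed convex set is separated from it by a half-space, whose mass is at most that of
the complement of the set.
\<close>

lemma floating_body_subset:
  assumes "closed S" "convex S" "S \<noteq> {}" and "prob (- S) < \<delta>"
  shows "floating_body \<mu> \<delta> \<subseteq> S"
proof (rule ccontr)
  assume "\<not> ?thesis"
  then obtain x where x: "x \<in> floating_body \<mu> \<delta>" "x \<notin> S"
    by blast
  obtain a b where ab: "a \<bullet> x < b" "\<forall>y\<in>S. b < a \<bullet> y"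
    using separating_hyperplane_closed_point[OF assms(2,1) x(2)] by blast
  have "a \<noteq> 0"
    using ab \<open>S \<noteq> {}\<close> by fastforce
  let ?H = "{y. a \<bullet> y < b}"
  have "?H \<in> {H \<in> open_halfspaces. x \<in> H}"
    using \<open>a \<noteq> 0\<close> ab by (auto simp: open_halfspaces_def)
  then have "halfspace_depth \<mu> x \<le> prob ?H"
    unfolding halfspace_depth_def by (intro cINF_lower bdd_belowI2[where m=0]) auto
  also have "\<dots> \<le> prob (- S)"
    using ab \<open>closed S\<close> by (intro finite_measure_mono) (force simp: sets_eq borel_closed borel_comp)+
  finally show False
    using x assms(4) by (simp add: floating_body_def)
qed

end

section \<open>The Hausdorff distance and its measurability\<close>

text \<open>
If both sets lie in the closure of \<open>W\<close>, it suffices that they come close to all points of a slightly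
contracted copy of \<open>W\<close>: the contraction displaces points of \<open>W\<close> by at most \<open>\<tau> D\<close>. Closed
inequalities for \<open>infdist\<close> extend from \<open>W\<close> to its closure.
\<close>

lemma hausdorff_distance_le_contraction:
  fixes K L W :: "'a::real_normed_vector set"
  assumes "K \<noteq> {}" "L \<noteq> {}" and sub: "K \<subseteq> closure W" "L \<subseteq> closure W"
    and W: "\<And>w. w \<in> W \<Longrightarrow> norm (w - a) \<le> D" and "0 \<le> \<tau>"
    and near: "\<And>w. w \<in> W \<Longrightarrow> infdist ((1 - \<tau>) *\<^sub>R w + \<tau> *\<^sub>R a) K \<le> e"
      "\<And>w. w \<in> W \<Longrightarrow> infdist ((1 - \<tau>) *\<^sub>R w + \<tau> *\<^sub>R a) L \<le> e"
  shows "hausdorff_distance K L \<le> \<tau> * D + e"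
proof -
  have le: "infdist y A \<le> \<tau> * D + e" 
    if A: "\<And>w. w \<in> W \<Longrightarrow> infdist ((1 - \<tau>) *\<^sub>R w + \<tau> *\<^sub>R a) A \<le> e" and y: "y \<in> closure W" for y A
  proof -
    have "infdist w A \<le> \<tau> * D + e" if "w \<in> W" for w
    proof -
      have "w - ((1 - \<tau>) *\<^sub>R w + \<tau> *\<^sub>R a) = \<tau> *\<^sub>R (w - a)"
        by (simp add: algebra_simps)
      then have "dist w ((1 - \<tau>) *\<^sub>R w + \<tau> *\<^sub>R a) \<le> \<tau> * D"
        using W[OF that] \<open>0 \<le> \<tau>\<close> by (simp add: dist_norm mult_left_mono)
      then show ?thesis
        using A[OF that] infdist_triangle[of w A "(1 - \<tau>) *\<^sub>R w + \<tau> *\<^sub>R a"] by linarith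
    qed
    then have "W \<subseteq> {y. infdist y A \<le> \<tau> * D + e}" by blast
    moreover have "closed {y. infdist y A \<le> \<tau> * D + e}"
      by (intro closed_Collect_le continuous_intros)
    ultimately show ?thesis
      using y closure_minimal by blast
  qed
  show ?thesis
    unfolding hausdorff_distance_def
    using assms le near by (intro max.boundedI cSUP_least) auto
qed

lemma random_polytope_weights:
  "random_polytope n x = {\<Sum>i<n. w i *\<^sub>R x i |w. (\<forall>i<n. 0 \<le> w i) \<and> sum w {..<n} = 1}" (is "_ = ?C")
proof
  have "convex ?C"
  proof (rule convexI)
    fix a b and u v :: real
    assume "a \<in> ?C" "b \<in> ?C" and uv: "0 \<le> u" "0 \<le> v" "u + v = 1"
    then obtain w w' where a: "a = (\<Sum>i<n. w i *\<^sub>R x i)" "\<forall>i<n. 0 \<le> w i" "sum w {..<n} = 1"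
      and b: "b = (\<Sum>i<n. w' i *\<^sub>R x i)" "\<forall>i<n. 0 \<le> w' i" "sum w' {..<n} = 1"
      by blast
    let ?w = "\<lambda>i. u * w i + v * w' i"
    have "u *\<^sub>R a + v *\<^sub>R b = (\<Sum>i<n. ?w i *\<^sub>R x i)"
      by (simp add: a b scaleR_sum_right scaleR_left_distrib sum.distrib)
    moreover have "sum ?w {..<n} = 1"
      using a b uv by (simp add: sum.distrib flip: sum_distrib_left)
    ultimately show "u *\<^sub>R a + v *\<^sub>R b \<in> ?C"
      using a b uv by (intro CollectI exI[of _ ?w]) auto
  qed
  moreover have "x ` {..<n} \<subseteq> ?C"
  proof clarify
    fix i assume "i < n"
    then show "\<exists>w. x i = (\<Sum>i<n. w i *\<^sub>R x i) \<and> (\<forall>i<n. 0 \<le> w i) \<and> sum w {..<n} = 1"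
      by (intro exI[of _ "\<lambda>j. if j = i then 1 else 0"]) (simp add: if_distrib[of "\<lambda>c. c *\<^sub>R _"] cong: if_cong)
  qed
  ultimately show "random_polytope n x \<subseteq> ?C"
    unfolding random_polytope_def by (simp add: hull_minimal)
  show "?C \<subseteq> random_polytope n x"
  proof clarify
    fix w :: "nat \<Rightarrow> real" assume "\<forall>i<n. 0 \<le> w i" "sum w {..<n} = 1"
    then show "(\<Sum>i<n. w i *\<^sub>R x i) \<in> random_polytope n x"
      unfolding random_polytope_def by (intro convex_sum convex_convex_hull) (auto intro: hull_inc)
  qed
qed

text \<open>
Points of the finite product have the value \<open>undefined\<close> at all indices from \<open>n\<close> on, so the sample space
embeds measurably into the space of all sequences. There, open sets of the product topology can be used.
\<close>

lemma measurable_iid_sample_product: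
  fixes \<mu> :: "'a::{second_countable_topology, topological_space} measure"
  assumes "sets \<mu> = sets borel"
  shows "(\<lambda>x. x) \<in> measurable (iid_sample n \<mu>) (borel :: (nat \<Rightarrow> 'a) measure)"
proof -
  have "(\<lambda>x. x) \<in> measurable (Pi\<^sub>M {..<n} (\<lambda>_. \<mu>)) (Pi\<^sub>M UNIV (\<lambda>_. borel :: 'a measure))"
  proof (rule measurable_PiM_single')
    fix i :: nat
    show "(\<lambda>x. x i) \<in> measurable (Pi\<^sub>M {..<n} (\<lambda>_. \<mu>)) (borel :: 'a measure)"
    proof (cases "i < n")
      case True
      then have "(\<lambda>x. x i) \<in> measurable (Pi\<^sub>M {..<n} (\<lambda>_. \<mu>)) \<mu>"
        by (intro measurable_component_singleton) simp
      then show ?thesis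
        using measurable_cong_sets[OF refl assms] by blast
    next
      case False
      then have "(\<lambda>x. x i) \<in> measurable (Pi\<^sub>M {..<n} (\<lambda>_. \<mu>)) borel \<longleftrightarrow>
        (\<lambda>x. undefined) \<in> measurable (Pi\<^sub>M {..<n} (\<lambda>_. \<mu>)) (borel :: 'a measure)"
        by (intro measurable_cong) (auto simp: space_PiM PiE_def extensional_def)
      then show ?thesis by simp
    qed
  qed auto
  then show ?thesis
    unfolding iid_sample_def using measurable_cong_sets[OF refl sets_PiM_equal_borel] by blast
qed

text \<open>
By the parametrisation of the hull by weights, the condition that the polytope stays near \<open>F\<close> is an
intersection of closed conditions on the sample, and the condition that the polytope comes strictly
closer than a given distance to a given point is a union of open ones. The condition at all points of
\<open>F\<close> reduces to a countable dense subset. Boundedness makes the suprema in the Hausdorff distance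
meaningful.
\<close>

lemma hausdorff_distance_event_measurable:
  fixes \<mu> :: "'a::euclidean_space measure"
  assumes "sets \<mu> = sets borel" and F: "F \<noteq> {}" "bounded F" and "n > 0"
  shows "{x \<in> space (iid_sample n \<mu>). hausdorff_distance (random_polytope n x) F \<le> \<rho>} \<in> sets (iid_sample n \<mu>)"
proof -
  let ?P = "random_polytope n :: (nat \<Rightarrow> 'a) \<Rightarrow> 'a set"
  let ?S = "{w :: nat \<Rightarrow> real. (\<forall>i<n. 0 \<le> w i) \<and> sum w {..<n} = 1}"
  have P: "?P x \<noteq> {}" "bounded (?P x)" for x
  proof -
    show "?P x \<noteq> {}"
      using \<open>n > 0\<close> by (auto simp: random_polytope_def convex_hull_eq_empty)
    show "bounded (?P x)"
      unfolding random_polytope_def by (intro bounded_convex_hull finite_imp_bounded) simp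
  qed
  have bdd: "bdd_above ((\<lambda>k. infdist k B) ` A)" if AB: "bounded A" "B \<noteq> {}" for A B :: "'a set"
  proof -
    obtain b where "b \<in> B"
      using AB by blast
    obtain e where "\<forall>a\<in>A. dist b a \<le> e"
      using AB bounded_any_center by blast
    then show ?thesis
      using \<open>b \<in> B\<close> by (intro bdd_aboveI2[where M=e]) (auto intro!: infdist_le2 simp: dist_commute)
  qed
  obtain T where T: "countable T" "T \<subseteq> F" "F \<subseteq> closure T"
    using separable by blast
  have iff: "hausdorff_distance (?P x) F \<le> \<rho> \<longleftrightarrow>
    (\<forall>w\<in>?S. infdist (\<Sum>i<n. w i *\<^sub>R x i) F \<le> \<rho>) \<and> (\<forall>l\<in>T. infdist l (?P x) \<le> \<rho>)" for x
  proof -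
    have "hausdorff_distance (?P x) F \<le> \<rho> \<longleftrightarrow> (\<forall>k\<in>?P x. infdist k F \<le> \<rho>) \<and> (\<forall>l\<in>F. infdist l (?P x) \<le> \<rho>)"
      unfolding hausdorff_distance_def using P F by (simp add: cSUP_le_iff bdd)
    moreover have "(\<forall>k\<in>?P x. infdist k F \<le> \<rho>) \<longleftrightarrow> (\<forall>w\<in>?S. infdist (\<Sum>i<n. w i *\<^sub>R x i) F \<le> \<rho>)"
      by (auto simp: random_polytope_weights)
    moreover have "(\<forall>l\<in>F. infdist l (?P x) \<le> \<rho>) \<longleftrightarrow> (\<forall>l\<in>T. infdist l (?P x) \<le> \<rho>)"
    proof
      assume "\<forall>l\<in>T. infdist l (?P x) \<le> \<rho>"
      then have "T \<subseteq> {l. infdist l (?P x) \<le> \<rho>}" by blast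
      moreover have "closed {l. infdist l (?P x) \<le> \<rho>}"
        by (intro closed_Collect_le continuous_intros)
      ultimately show "\<forall>l\<in>F. infdist l (?P x) \<le> \<rho>"
        using T(3) closure_minimal by blast
    qed (use T in blast)
    ultimately show ?thesis by blast
  qed
  have cont: "continuous_on UNIV (\<lambda>x :: nat \<Rightarrow> 'a. \<Sum>i<n. w i *\<^sub>R x i)" for w :: "nat \<Rightarrow> real"
    by (intro continuous_intros continuous_on_product_coordinates)
  have "closed (\<Inter>w\<in>?S. {x :: nat \<Rightarrow> 'a. infdist (\<Sum>i<n. w i *\<^sub>R x i) F \<le> \<rho>})"
    by (intro closed_INT ballI closed_Collect_le continuous_on_infdist cont continuous_on_const)
  then have 1: "(\<Inter>w\<in>?S. {x :: nat \<Rightarrow> 'a. infdist (\<Sum>i<n. w i *\<^sub>R x i) F \<le> \<rho>}) \<in> sets borel"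
    by (rule borel_closed)
  have 2: "(\<lambda>x. infdist l (?P x)) \<in> borel_measurable borel" for l
    unfolding borel_measurable_iff_less
  proof
    fix a
    have "{x \<in> space borel. infdist l (?P x) < a} = (\<Union>w\<in>?S. {x. dist l (\<Sum>i<n. w i *\<^sub>R x i) < a})"
      using P by (auto simp: infdist_notempty cINF_less_iff random_polytope_weights)
    moreover have "open \<dots>"
      by (intro open_UN ballI open_Collect_less continuous_on_dist cont continuous_on_const)
    ultimately show "{x \<in> space borel. infdist l (?P x) < a} \<in> sets borel"
      by simp
  qed
  have "{x. \<forall>l\<in>T. infdist l (?P x) \<le> \<rho>} \<in> sets borel"
    using 2 T(1) by (auto intro!: sets.sets_Collect_countable_Ball pred_Collect_borel simp: pred_def)
  with 1 have "(\<Inter>w\<in>?S. {x :: nat \<Rightarrow> 'a. infdist (\<Sum>i<n. w i *\<^sub>R x i) F \<le> \<rho>}) \<inter> {x. \<forall>l\<in>T. infdist l (?P x) \<le> \<rho>} \<in> sets borel"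
    by blast
  also have "(\<Inter>w\<in>?S. {x :: nat \<Rightarrow> 'a. infdist (\<Sum>i<n. w i *\<^sub>R x i) F \<le> \<rho>}) \<inter> {x. \<forall>l\<in>T. infdist l (?P x) \<le> \<rho>}
      = {x. hausdorff_distance (?P x) F \<le> \<rho>}"
    unfolding iff by blast
  finally have "(\<lambda>x. x) -` {x. hausdorff_distance (?P x) F \<le> \<rho>} \<inter> space (iid_sample n \<mu>) \<in> sets (iid_sample n \<mu>)"
    by (rule measurable_sets[OF measurable_iid_sample_product[OF assms(1)]])
  moreover have "{x \<in> space (iid_sample n \<mu>). hausdorff_distance (?P x) F \<le> \<rho>}
      = (\<lambda>x. x) -` {x. hausdorff_distance (?P x) F \<le> \<rho>} \<inter> space (iid_sample n \<mu>)"
    by auto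
  ultimately show ?thesis by simp
qed

section \<open>Samples hitting a net of balls\<close>

context log_concave_measure
begin

text \<open>
A \<open>2 \<rho>\<close>-separated subset of largest cardinality is a net; the packing bound makes the
cardinalities bounded.
\<close>

lemma ex_separated_net:
  fixes \<rho> m :: real
  assumes "\<rho> > 0" "m > 0" and mass: "\<And>z. z \<in> M \<Longrightarrow> m \<le> prob (ball z \<rho>)"
  shows "\<exists>Z\<subseteq>M. finite Z \<and> card Z * m \<le> 1 \<and> (\<forall>z\<in>M. \<exists>y\<in>Z. dist z y < 2 * \<rho>)"
proof -
  define sep where "sep Z \<longleftrightarrow> Z \<subseteq> M \<and> finite Z \<and> (\<forall>y\<in>Z. \<forall>z\<in>Z. y \<noteq> z \<longrightarrow> 2 * \<rho> \<le> dist y z)" for Z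
  have card: "card Z * m \<le> 1" if "sep Z" for Z
    using that mass unfolding sep_def by (intro card_separated_le[where \<rho>=\<rho>]) auto
  obtain b :: nat where b: "b * m > 1"
    using reals_Archimedean3[OF \<open>m > 0\<close>] by blast
  have less: "card Z < b" if "sep Z" for Z
  proof -
    have "card Z * m < b * m"
      using card[OF that] b by linarith
    then show ?thesis
      using \<open>m > 0\<close> by simp
  qed
  have "sep {}"
    by (simp add: sep_def)
  then obtain Z where Z: "sep Z" and max: "\<And>Y. sep Y \<Longrightarrow> card Y \<le> card Z"
    using ex_has_greatest_nat[of sep "{}" card b] less by blast
  have "\<exists>y\<in>Z. dist z y < 2 * \<rho>" if "z \<in> M" for z
  proof (rule ccontr)
    assume far: "\<not> ?thesis"
    then have "sep (insert z Z)"
      using Z that unfolding sep_def by (auto simp: dist_commute not_less)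
    moreover have "z \<notin> Z"
      using far \<open>\<rho> > 0\<close> by force
    ultimately show False
      using max[of "insert z Z"] Z by (simp add: sep_def)
  qed
  then show ?thesis
    using Z card unfolding sep_def by blast
qed

text \<open>
A union bound: the event \<open>E\<close> can fail only if some point of the sample is outside \<open>S\<close>, or if all
\<open>n\<close> points miss some ball of mass at least \<open>m\<close>. The latter has probability at most
\<open>(1 - m)\<^sup>n \<le> exp (- n m)\<close> for each ball.
\<close>

lemma prob_sample_hits:
  fixes \<rho> m :: real
  assumes "closed S" "finite Z" and mass: "\<And>z. z \<in> Z \<Longrightarrow> m \<le> prob (ball z \<rho>)"
    and E: "E \<in> sets (iid_sample n \<mu>)"
    and sub: "\<And>x. x \<in> space (iid_sample n \<mu>) \<Longrightarrow> (\<And>i. i < n \<Longrightarrow> x i \<in> S) \<Longrightarrow>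
      (\<And>z. z \<in> Z \<Longrightarrow> \<exists>i<n. x i \<in> ball z \<rho>) \<Longrightarrow> x \<in> E"
  shows "measure (iid_sample n \<mu>) E \<ge> 1 - n * prob (- S) - card Z * exp (- (n * m))"
proof -
  interpret P: finite_product_prob_space "\<lambda>_. \<mu>" "{..<n}"
    by unfold_locales auto
  let ?I = "Pi\<^sub>M {..<n} (\<lambda>_. \<mu>)"
  define A where "A i = {x \<in> space ?I. x i \<in> - S}" for i
  define B where "B z = (\<Pi>\<^sub>E i\<in>{..<n}. - ball z \<rho>)" for z :: 'a
  have S: "- S \<in> sets \<mu>" and ball: "- ball z \<rho> \<in> sets \<mu>" for z
    using \<open>closed S\<close> by (auto simp: sets_eq borel_closed borel_comp)
  have A: "A i \<in> sets ?I" "P.prob (A i) = prob (- S)" if "i < n" for i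
  proof -
    have comp: "(\<lambda>x. x i) \<in> measurable ?I \<mu>"
      using that by (intro measurable_component_singleton) simp
    show "A i \<in> sets ?I"
      unfolding A_def using comp S by measurable
    have "distr ?I \<mu> (\<lambda>x. x i) = \<mu>"
      using that by (intro distr_PiM_component) (auto intro: prob_space_axioms)
    moreover have "A i = (\<lambda>x. x i) -` (- S) \<inter> space ?I"
      by (auto simp: A_def)
    ultimately show "P.prob (A i) = prob (- S)"
      using measure_distr[OF comp S] by simp
  qed
  have B: "B z \<in> sets ?I" for z
    unfolding B_def using ball by (intro sets_PiM_I_finite) auto
  have PB: "P.prob (B z) \<le> exp (- (n * m))" if "z \<in> Z" for z
  proof -
    have "P.prob (B z) = prob (- ball z \<rho>) ^ n"
      unfolding B_def using ball by (subst P.prob_times) auto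
    also have "prob (- ball z \<rho>) = 1 - prob (ball z \<rho>)"
      using prob_compl[of "ball z \<rho>"] by (simp add: space_eq sets_eq Compl_eq_Diff_UNIV)
    also have "(1 - prob (ball z \<rho>)) ^ n \<le> exp (- m) ^ n"
      using mass[OF that] exp_ge_add_one_self[of "- m"] by (intro power_mono) auto
    finally show ?thesis
      by (simp add: exp_of_nat_mult[symmetric])
  qed
  let ?bad = "(\<Union>i<n. A i) \<union> (\<Union>z\<in>Z. B z)"
  have meas: "(\<Union>i<n. A i) \<in> sets ?I" "(\<Union>z\<in>Z. B z) \<in> sets ?I"
    using A B \<open>finite Z\<close> by auto
  have "space ?I - ?bad \<subseteq> E"
  proof
    fix x assume x: "x \<in> space ?I - ?bad"
    show "x \<in> E"
    proof (rule sub)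
      show "x \<in> space (iid_sample n \<mu>)"
        using x by (simp add: iid_sample_def)
      show "x i \<in> S" if "i < n" for i
        using x that by (auto simp: A_def)
      show "\<exists>i<n. x i \<in> ball z \<rho>" if "z \<in> Z" for z
        using x that by (auto simp: B_def space_PiM PiE_iff space_eq)
    qed
  qed
  then have "P.prob (space ?I - ?bad) \<le> measure (iid_sample n \<mu>) E"
    using E unfolding iid_sample_def by (intro P.finite_measure_mono) auto
  moreover have "P.prob (space ?I - ?bad) = 1 - P.prob ?bad"
    using meas by (intro P.prob_compl) auto
  moreover have "P.prob ?bad \<le> P.prob (\<Union>i<n. A i) + P.prob (\<Union>z\<in>Z. B z)"
    using meas by (rule measure_Un_le)
  moreover have "P.prob (\<Union>i<n. A i) \<le> (\<Sum>i<n. P.prob (A i))"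
    using A by (intro P.finite_measure_subadditive_finite) auto
  moreover have "(\<Sum>i<n. P.prob (A i)) = n * prob (- S)"
    using A by simp
  moreover have "P.prob (\<Union>z\<in>Z. B z) \<le> (\<Sum>z\<in>Z. P.prob (B z))"
    using B \<open>finite Z\<close> by (intro P.finite_measure_subadditive_finite) auto
  moreover have "(\<Sum>z\<in>Z. P.prob (B z)) \<le> card Z * exp (- (n * m))"
    using PB by (rule sum_bounded_above)
  ultimately show ?thesis by linarith
qed

section \<open>Comparison of the random polytope with the floating body\<close>

text \<open>
The comparison at fixed \<open>n\<close>. Polytope and floating body are compared with the superlevel set \<open>W\<close>
at level \<open>s\<close>. Outside the closure of \<open>W\<close> there is too little mass for a point of the floating
body, and with high probability there is no point of the sample. In the other direction, every point
of \<open>W\<close>, once contracted by \<open>\<tau>\<close>, is the centre of a ball of mass at least \<open>m \<ge> 1 / n\<close> inside the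
smaller superlevel set at level \<open>s'\<close>. So the contracted point lies in the floating body, and a net of
such balls is likely to be hit by the sample once \<open>n m\<close> is large.
\<close>

lemma prob_polytope_near_floating_body:
  fixes r \<tau> D s s' s0 :: real
  assumes ball: "ball x0 r \<subseteq> superlevel f s0" and "r > 0" "s0 \<le> s"
    and \<tau>: "0 < \<tau>" "\<tau> \<le> 1" and s': "(1 - \<tau>) * s + \<tau> * s0 \<le> s'"
    and D: "\<And>x. x \<in> superlevel f s \<Longrightarrow> norm (x - x0) \<le> D"
    and m: "m = exp (- s') * (unit_ball_vol DIM('a) * (\<tau> * r / 2) ^ DIM('a))"
    and nm: "1 \<le> n * m" and out: "n * prob (- closure (superlevel f s)) < 1"
    and c: "\<tau> * (D + 2 * r) \<le> c"
  shows "\<P>(x in iid_sample n \<mu>. hausdorff_distance (random_polytope n x) (floating_body \<mu> (1 / n)) \<le> c)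
    \<ge> 1 - n * prob (- closure (superlevel f s)) - n * exp (- (n * m))"
proof -
  let ?W = "superlevel f s" and ?F = "floating_body \<mu> (1 / n)"
  define \<rho> where "\<rho> = \<tau> * r / 2"
  define T where "T w = (1 - \<tau>) *\<^sub>R w + \<tau> *\<^sub>R x0" for w
  have "\<rho> > 0"
    using \<tau> \<open>r > 0\<close> by (simp add: \<rho>_def)
  have "m > 0"
    using \<tau> \<open>r > 0\<close> by (simp add: m)
  have "n > 0"
    using nm by (cases n) auto
  have "x0 \<in> ?W"
    using ball \<open>r > 0\<close> superlevel_mono[OF \<open>s0 \<le> s\<close>, of f] by force
  then have "?W \<noteq> {}" by blast
  have inner: "ball (T w) (2 * \<rho>) \<subseteq> superlevel f s'" if "w \<in> ?W" for w
    using contraction_ball_superlevel[OF log_concave ball that, of \<tau>] \<tau> superlevel_mono[OF s', of f]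
    by (auto simp: T_def \<rho>_def)
  have mass: "m \<le> prob (ball z \<rho>)" if "z \<in> T ` ?W" for z
  proof -
    have "ball z \<rho> \<subseteq> superlevel f s'"
      using inner that \<open>\<rho> > 0\<close> subset_ball[of \<rho> "2 * \<rho>" z] by fastforce
    then show ?thesis
      unfolding m \<rho>_def[symmetric] using \<open>\<rho> > 0\<close> by (intro prob_ball_ge) auto
  qed
  have TF: "T w \<in> ?F" if "w \<in> ?W" for w
    using inner[OF that] \<open>\<rho> > 0\<close> nm \<open>n > 0\<close> unfolding m \<rho>_def[symmetric]
    by (intro mem_floating_body[of _ \<rho> s']) (auto simp: divide_le_eq mult.commute)
  have "?F \<subseteq> closure ?W"
    using out \<open>n > 0\<close> \<open>?W \<noteq> {}\<close>
    by (intro floating_body_subset convex_closure convex_superlevel log_concave)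
      (auto simp: less_divide_eq mult.commute)
  have "?F \<noteq> {}"
    using TF \<open>x0 \<in> ?W\<close> by blast
  have "bounded ?F"
    using \<open>?F \<subseteq> closure ?W\<close> bounded_superlevel bounded_closure bounded_subset by blast
  obtain Z where Z: "Z \<subseteq> T ` ?W" "finite Z" "card Z * m \<le> 1" "\<forall>z\<in>T ` ?W. \<exists>y\<in>Z. dist z y < 2 * \<rho>"
    using ex_separated_net[OF \<open>\<rho> > 0\<close> \<open>m > 0\<close> mass] by blast
  have "card Z * m \<le> n * m"
    using Z nm by linarith
  then have "card Z \<le> n"
    using \<open>m > 0\<close> by simp
  let ?E = "{x \<in> space (iid_sample n \<mu>). hausdorff_distance (random_polytope n x) ?F \<le> c}"
  have "measure (iid_sample n \<mu>) ?E \<ge> 1 - n * prob (- closure ?W) - card Z * exp (- (n * m))"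
  proof (rule prob_sample_hits)
    show "?E \<in> sets (iid_sample n \<mu>)"
      using sets_eq \<open>?F \<noteq> {}\<close> \<open>bounded ?F\<close> \<open>n > 0\<close> by (rule hausdorff_distance_event_measurable)
    fix x assume x: "x \<in> space (iid_sample n \<mu>)" and in_W: "\<And>i. i < n \<Longrightarrow> x i \<in> closure ?W"
      and hit: "\<And>z. z \<in> Z \<Longrightarrow> \<exists>i<n. x i \<in> ball z \<rho>"
    let ?P = "random_polytope n x"
    have vertex: "x i \<in> ?P" if "i < n" for i
      using that by (simp add: random_polytope_def hull_inc)
    have "hausdorff_distance ?P ?F \<le> \<tau> * D + 3 * \<rho>"
    proof (rule hausdorff_distance_le_contraction[where a=x0 and W="?W"])
      show "?P \<noteq> {}"
        using vertex \<open>n > 0\<close> by blast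
      show "?P \<subseteq> closure ?W"
        unfolding random_polytope_def using in_W
        by (intro hull_minimal convex_closure convex_superlevel log_concave) auto
      fix w assume w: "w \<in> ?W"
      then show "infdist ((1 - \<tau>) *\<^sub>R w + \<tau> *\<^sub>R x0) ?F \<le> 3 * \<rho>"
        using TF \<open>\<rho> > 0\<close> by (simp add: T_def)
      obtain y i where y: "y \<in> Z" "dist (T w) y < 2 * \<rho>" "i < n" "x i \<in> ball y \<rho>"
        using Z(4) hit w by blast
      then have "dist (T w) (x i) \<le> 3 * \<rho>"
        using dist_triangle[of "T w" "x i" y] by simp
      then show "infdist ((1 - \<tau>) *\<^sub>R w + \<tau> *\<^sub>R x0) ?P \<le> 3 * \<rho>"
        using vertex[OF y(3)] by (auto simp: T_def intro: infdist_le2)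
    qed (use D \<tau> \<open>?F \<noteq> {}\<close> \<open>?F \<subseteq> closure ?W\<close> in auto)
    also have "3 * \<rho> \<le> \<tau> * (2 * r)"
      using \<tau> \<open>r > 0\<close> by (simp add: \<rho>_def)
    finally show "x \<in> ?E"
      using x c by (simp add: distrib_left)
  qed (use Z mass in auto)
  moreover have "card Z * exp (- (n * m)) \<le> n * exp (- (n * m))"
    using \<open>card Z \<le> n\<close> by (intro mult_right_mono) auto
  ultimately show ?thesis by linarith
qed

text \<open>
With \<open>N = ln n\<close> and \<open>l = ln N\<close>, the levels are \<open>N + K l\<close> and \<open>N - K l\<close>, at densities
\<open>N\<^bsup>-K\<^esup> / n\<close> and \<open>N\<^bsup>K\<^esup> / n\<close>. The gap between them costs a contraction
\<open>\<tau>\<close> of order \<open>l / N\<close>, hence the error \<open>\<tau> N\<^bsup>1/p\<^esup>\<close>. The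
estimates of masses lose at most a factor of order \<open>N\<^sup>d\<close>, where \<open>d\<close> is the dimension.
\<close>

lemma polytope_near_floating_body_eventually:
  fixes p q :: real
  assumes f: "p_log_concave p f" and "p > 1" "q > 0"
  shows "\<exists>c>0. \<exists>C>0. \<forall>\<^sub>F n in sequentially.
    \<P>(x in iid_sample n \<mu>. hausdorff_distance (random_polytope n x) (floating_body \<mu> (1 / real n))
        \<le> c * (ln (ln (real n)) / ln (real n) powr (1 - 1 / p)))
      \<ge> 1 - C * ln (real n) powr (- q)"
proof -
  let ?d = "DIM('a)"
  obtain x0 r s0 where "r > 0" and ball: "ball x0 r \<subseteq> superlevel f s0"
    using ex_ball_superlevel by blast
  obtain R where "R > 0" and R: "\<And>s x. s \<ge> 1 \<Longrightarrow> x \<in> superlevel f s \<Longrightarrow> norm (x - x0) \<le> R * s powr (1 / p)"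
    using superlevel_p_growth[OF f, of x0] \<open>p > 1\<close> by auto
  have R1: "norm (x - x0) \<le> R * s" if "s \<ge> 1" "x \<in> superlevel f s" for s x
  proof -
    have "s powr (1 / p) \<le> s powr 1"
      using that \<open>p > 1\<close> by (intro powr_mono) auto
    then have "R * s powr (1 / p) \<le> R * s"
      using \<open>R > 0\<close> that by simp
    then show ?thesis
      using R[OF that] by linarith
  qed
  \<comment> \<open>\<open>d + q\<close> leaves the factor \<open>N\<^bsup>-q\<^esup>\<close> in the outer tail; the extra 3 makes the balls of
    the net have mass at least \<open>N\<^sup>2 / n\<close>, so that a union bound over up to \<open>n\<close> of them is harmless\<close>
  define K where "K = ?d + q + 3"
  define C1 where "C1 = exp 1 * (2 * ?d * R * (1 + K)) ^ ?d"
  define c1 where "c1 = unit_ball_vol ?d * (2 * K * r) ^ ?d"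
  define c where "c = 4 * K * (R * (1 + K) powr (1 / p) + 2 * r)"
  have "K > 0"
    using \<open>q > 0\<close> by (simp add: K_def)
  have "C1 > 0" "c1 > 0" "c > 0"
    using \<open>K > 0\<close> \<open>R > 0\<close> \<open>r > 0\<close> by (auto simp: C1_def c1_def c_def intro!: mult_pos_pos add_nonneg_pos)
  have "\<forall>\<^sub>F N in at_top. 1 \<le> ln N \<and> 4 * K * ln N / N \<le> 1 \<and> 1 \<le> N \<and> 2 * \<bar>s0\<bar> \<le> N \<and>
      C1 * N powr (- q) < 1 \<and> 1 \<le> c1 * N \<and> exp (N - N\<^sup>2) \<le> N powr (- q)"
  proof (intro eventually_conj)
    show "\<forall>\<^sub>F N :: real in at_top. 1 \<le> ln N"
      by real_asymp
    show "\<forall>\<^sub>F N in at_top. 4 * K * ln N / N \<le> 1"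
      using \<open>K > 0\<close> by real_asymp
    show "\<forall>\<^sub>F N in at_top. C1 * N powr (- q) < 1"
      using \<open>C1 > 0\<close> \<open>q > 0\<close> by real_asymp
    show "\<forall>\<^sub>F N in at_top. 1 \<le> c1 * N"
      using \<open>c1 > 0\<close> by real_asymp
    show "\<forall>\<^sub>F N in at_top. exp (N - N\<^sup>2) \<le> N powr (- q)"
      using \<open>q > 0\<close> by real_asymp
  qed (auto intro: eventually_ge_at_top)
  moreover have "filterlim (\<lambda>n. ln (real n)) at_top sequentially"
    by real_asymp
  ultimately have "\<forall>\<^sub>F n in sequentially. 1 \<le> ln (ln (real n)) \<and> 4 * K * ln (ln (real n)) / ln (real n) \<le> 1 \<and>
      1 \<le> ln (real n) \<and> 2 * \<bar>s0\<bar> \<le> ln (real n) \<and> C1 * ln (real n) powr (- q) < 1 \<and> 1 \<le> c1 * ln (real n) \<and>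
      exp (ln (real n) - (ln (real n))\<^sup>2) \<le> ln (real n) powr (- q)"
    by (rule eventually_compose_filterlim)
  then have "\<forall>\<^sub>F n in sequentially.
    \<P>(x in iid_sample n \<mu>. hausdorff_distance (random_polytope n x) (floating_body \<mu> (1 / real n))
        \<le> c * (ln (ln (real n)) / ln (real n) powr (1 - 1 / p)))
      \<ge> 1 - (C1 + 1) * ln (real n) powr (- q)"
  proof eventually_elim
    case (elim n)
    define N where "N = ln (real n)"
    define l where "l = ln N"
    define s where "s = N + K * l"
    define s' where "s' = N - K * l"
    define \<tau> where "\<tau> = 4 * K * l / N"
    define m where "m = exp (- s') * (unit_ball_vol ?d * (\<tau> * r / 2) ^ ?d)"
    from elim have N: "1 \<le> l" "\<tau> \<le> 1" "1 \<le> N" "2 * \<bar>s0\<bar> \<le> N" "C1 * N powr (- q) < 1" "1 \<le> c1 * N"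
        "exp (N - N\<^sup>2) \<le> N powr (- q)"
      unfolding N_def[symmetric] l_def[symmetric] \<tau>_def[symmetric] by blast+
    have "n > 0"
      using \<open>1 \<le> N\<close> by (cases n) (auto simp: N_def)
    then have n: "real n = exp N"
      by (simp add: N_def)
    have NK: "exp (K * l) = N powr K"
      using N(3) by (simp add: powr_def l_def)
    have "l \<le> N"
      using ln_le_minus_one[of N] N(3) by (simp add: l_def)
    then have "K * l \<le> K * N" "0 \<le> K * l"
      using \<open>K > 0\<close> N by auto
    then have s: "1 \<le> s" "s \<le> (1 + K) * N" "s0 \<le> s" "N / 2 \<le> s - s0"
      using N by (auto simp: s_def algebra_simps)
    have out: "n * prob (- closure (superlevel f s)) \<le> C1 * N powr (- q)"
    proof -
      have "prob (- closure (superlevel f s)) \<le> exp (1 - s) * (2 * ?d * R * s) ^ ?d"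
        using R1 \<open>R > 0\<close> s(1) by (rule prob_outside_superlevel_le)
      also have "\<dots> \<le> exp (1 - s) * (2 * ?d * R * ((1 + K) * N)) ^ ?d"
        using s \<open>R > 0\<close> by (intro mult_left_mono power_mono) auto
      also have "\<dots> = C1 * exp (- s) * N ^ ?d"
        by (simp add: C1_def power_mult_distrib exp_diff exp_minus divide_inverse)
      finally have "n * prob (- closure (superlevel f s)) \<le> n * (C1 * exp (- s) * N ^ ?d)"
        by (rule mult_left_mono) simp
      also have "\<dots> = C1 * (exp N * exp (- s)) * N powr ?d"
        using N(3) by (simp add: n powr_realpow)
      also have "exp N * exp (- s) = N powr (- K)"
        by (simp add: s_def powr_minus NK[symmetric] flip: exp_add exp_minus)
      also have "C1 * N powr (- K) * N powr ?d = C1 * N powr (- (q + 3))"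
        by (simp add: K_def flip: powr_add)
      also have "\<dots> \<le> C1 * N powr (- q)"
        using \<open>C1 > 0\<close> N(3) by (intro mult_left_mono powr_mono) auto
      finally show ?thesis .
    qed
    have nm: "N\<^sup>2 \<le> n * m"
    proof -
      have Krl: "2 * K * r * 1 \<le> 2 * K * r * l"
        using N(1) \<open>K > 0\<close> \<open>r > 0\<close> by (intro mult_left_mono) auto
      have "N\<^sup>2 * 1 \<le> N\<^sup>2 * (c1 * N)"
        using N by (intro mult_left_mono) auto
      also have "\<dots> = c1 * N powr 3"
        using N(3) by (simp add: powr_numeral power2_eq_square power3_eq_cube)
      also have "\<dots> \<le> c1 * N powr (K - ?d)"
        using \<open>c1 > 0\<close> N(3) \<open>q > 0\<close> by (intro mult_left_mono powr_mono) (auto simp: K_def)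
      also have "\<dots> = N powr K * (unit_ball_vol ?d * (2 * K * r / N) ^ ?d)"
        using N(3) by (simp add: c1_def powr_diff powr_realpow power_divide)
      also have "\<dots> \<le> N powr K * (unit_ball_vol ?d * (2 * K * r * l / N) ^ ?d)"
        using N(3) \<open>K > 0\<close> \<open>r > 0\<close> Krl by (intro mult_left_mono power_mono divide_right_mono) auto
      also have "N powr K = n * exp (- s')"
        by (simp add: n s'_def NK[symmetric] flip: exp_add)
      also have "2 * K * r * l / N = \<tau> * r / 2"
        by (simp add: \<tau>_def)
      finally show ?thesis
        by (simp add: m_def mult.assoc)
    qed
    have "1 \<le> N\<^sup>2"
      using N(3) by simp
    have "\<P>(x in iid_sample n \<mu>. hausdorff_distance (random_polytope n x) (floating_body \<mu> (1 / n))
        \<le> c * (l / N powr (1 - 1 / p))) \<ge> 1 - n * prob (- closure (superlevel f s)) - n * exp (- (n * m))"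
    proof (rule prob_polytope_near_floating_body[OF ball \<open>r > 0\<close> s(3) _ N(2)])
      show "0 < \<tau>"
        using N \<open>K > 0\<close> by (simp add: \<tau>_def)
      have "2 * K * l = \<tau> * (N / 2)"
        using N(3) by (simp add: \<tau>_def)
      also have "\<dots> \<le> \<tau> * (s - s0)"
        using s(4) \<open>0 < \<tau>\<close> by (intro mult_left_mono) auto
      finally show "(1 - \<tau>) * s + \<tau> * s0 \<le> s'"
        by (simp add: s_def s'_def algebra_simps)
      show "norm (x - x0) \<le> R * s powr (1 / p)" if "x \<in> superlevel f s" for x
        using R[OF s(1) that] .
      show "m = exp (- s') * (unit_ball_vol ?d * (\<tau> * r / 2) ^ ?d)"
        by (fact m_def)
      show "1 \<le> n * m"
        using nm \<open>1 \<le> N\<^sup>2\<close> by linarith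
      show "n * prob (- closure (superlevel f s)) < 1"
        using out N(5) by linarith
      have "s powr (1 / p) \<le> (1 + K) powr (1 / p) * N powr (1 / p)"
        using s \<open>K > 0\<close> N(3) \<open>p > 1\<close> by (subst powr_mult[symmetric]) (auto intro: powr_mono2)
      then have "R * s powr (1 / p) \<le> R * ((1 + K) powr (1 / p) * N powr (1 / p))"
        using \<open>R > 0\<close> by simp
      moreover have "2 * r * 1 \<le> 2 * r * N powr (1 / p)"
        using \<open>r > 0\<close> N(3) \<open>p > 1\<close> by (intro mult_left_mono ge_one_powr_ge_zero) auto
      ultimately have "R * s powr (1 / p) + 2 * r \<le> (R * (1 + K) powr (1 / p) + 2 * r) * N powr (1 / p)"
        by (simp add: algebra_simps)
      then have "\<tau> * (R * s powr (1 / p) + 2 * r) \<le> \<tau> * ((R * (1 + K) powr (1 / p) + 2 * r) * N powr (1 / p))"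
        using \<open>0 < \<tau>\<close> by simp
      also have "\<dots> = c * (l * (N powr (1 / p) / N))"
        by (simp add: \<tau>_def c_def)
      also have "N powr (1 / p) / N = 1 / N powr (1 - 1 / p)"
        using N(3) by (simp add: powr_diff)
      finally show "\<tau> * (R * s powr (1 / p) + 2 * r) \<le> c * (l / N powr (1 - 1 / p))"
        by simp
    qed
    moreover have "n * exp (- (n * m)) \<le> N powr (- q)"
    proof -
      have "n * exp (- (n * m)) \<le> exp N * exp (- N\<^sup>2)"
        using nm by (simp add: n)
      also have "\<dots> = exp (N - N\<^sup>2)"
        by (simp flip: exp_add)
      also have "\<dots> \<le> N powr (- q)"
        by (fact N(7))
      finally show ?thesis .
    qed
    ultimately show ?case
      using out unfolding N_def[symmetric] l_def[symmetric] by (simp add: distrib_right)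
  qed
  then show ?thesis
    using \<open>c > 0\<close> \<open>C1 > 0\<close> by (intro exI[of _ c] exI[of _ "C1 + 1"] conjI) auto
qed

end

theorem theorem2:
  fixes q p :: real and \<mu> :: "(real ^ 'd) measure" and f :: "real ^ 'd \<Rightarrow> real"
  assumes "q > 0" and "p > 1"
    and "prob_space \<mu>" and "has_density \<mu> f" and "p_log_concave p f"
  shows "\<exists>c c'. c > 0 \<and> c' > 0 \<and>
    (\<forall>n::nat. n \<ge> CARD('d) + 2 \<longrightarrow>
      \<P>(x in iid_sample n \<mu>.
          hausdorff_distance (random_polytope n x) (floating_body \<mu> (1 / real n))
            \<le> c * (ln (ln (real n)) / ln (real n) powr (1 - 1 / p)))
        \<ge> 1 - c' * ln (real n) powr (- q))"
proof -
  interpret prob_space \<mu> by fact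
  interpret log_concave_measure \<mu> f
    using assms by unfold_locales (auto intro: p_log_concave_imp_log_concave[of p])
  obtain c C n0 where "c > 0" "C > 0" and large: "\<And>n. n \<ge> n0 \<Longrightarrow>
    \<P>(x in iid_sample n \<mu>. hausdorff_distance (random_polytope n x) (floating_body \<mu> (1 / real n))
        \<le> c * (ln (ln (real n)) / ln (real n) powr (1 - 1 / p)))
      \<ge> 1 - C * ln (real n) powr (- q)"
    using polytope_near_floating_body_eventually[OF assms(5,2,1)] unfolding eventually_sequentially by blast
  \<comment> \<open>The second summand makes the claimed bound nonpositive, hence trivial, for \<open>n < n0\<close>.\<close>
  define c' where "c' = C + ln (real (n0 + 3)) powr q"
  have "\<P>(x in iid_sample n \<mu>. hausdorff_distance (random_polytope n x) (floating_body \<mu> (1 / real n))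
        \<le> c * (ln (ln (real n)) / ln (real n) powr (1 - 1 / p)))
      \<ge> 1 - c' * ln (real n) powr (- q)" if "n \<ge> CARD('d) + 2" for n
  proof -
    have "1 \<le> CARD('d)"
      by (simp add: Suc_leI)
    then have "n \<ge> 3"
      using that by linarith
    then have "ln (real n) > 0"
      by (intro ln_gt_zero) auto
    show ?thesis
    proof (cases "n \<ge> n0")
      case True
      have "C * ln (real n) powr (- q) \<le> c' * ln (real n) powr (- q)"
        by (intro mult_right_mono) (auto simp: c'_def)
      then show ?thesis
        using large[OF True] by linarith
    next
      case False
      then have "ln (real n) powr q \<le> ln (real (n0 + 3)) powr q"
        using \<open>n \<ge> 3\<close> \<open>ln (real n) > 0\<close> \<open>q > 0\<close> by (intro powr_mono2) auto
      then have "ln (real n) powr q \<le> c'"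
        using \<open>C > 0\<close> by (simp add: c'_def)
      then have "ln (real n) powr q * ln (real n) powr (- q) \<le> c' * ln (real n) powr (- q)"
        by (rule mult_right_mono) simp
      moreover have "ln (real n) powr q * ln (real n) powr (- q) = 1"
        using \<open>ln (real n) > 0\<close> by (simp flip: powr_add)
      ultimately have "1 - c' * ln (real n) powr (- q) \<le> 0"
        by linarith
      then show ?thesis
        using measure_nonneg order_trans by blast
    qed
  qed
  moreover have "c' > 0"
    using \<open>C > 0\<close> by (simp add: c'_def add_pos_nonneg)
  ultimately show ?thesis
    using \<open>c > 0\<close> by blast
qed

end
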